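(* Let $G$ be a graph and let $C$ be an induced subgraph of $G$ with $C\approx C_4$. Then $$\deg(G)\ \ge\ 2+\sum_{v\in V(G)-V(C)}\ \sum_{H\in\mathcal{H}_v}\deg(H),$$ with equality if and only if $\mathcal{Q}_G=\{C\}\cup\bigcup_{v\in V(G)-V(C)}\mathcal{H}_v$. Consequently, at most $\lfloor(\deg(G)-2)/2\rfloor$ vertices distinguish $V(C)$. In particular, $V(C)$ is a module of $G$ if $\deg(G)\le 3$; and if $\deg(G)\le 5$, then at most one vertex $v$ distinguishes $V(C)$, and (for such a $v$) $N_G(v)\cap V(C)$ is not a pair of opposite vertices of $C$.
   Context: Graphs are finite and simple; $\approx$ is isomorphism. A 2-switch on $G$: given four distinct vertices $a,b,x,y$ with $ab,xy\in E(G)$ and $ax,by\notin E(G)$, delete the edges $ab,xy$ and add the edges $ax,by$ (two 2-switches are equal iff they delete the same two edges and add the same two edges). The 2-switch-degree $\deg(G)$ is the number of distinct 2-switches that can be performed on $G$. $\mathcal{Q}_G$ is the set of induced subgraphs of $G$ isomorphic to $P_4$, $C_4$ or $2K_2$. For $M\subseteq V(G)$, a vertex $v\in V(G)-M$ distinguishes $M$ if $\varnothing\ne N_G(v)\cap M\ne M$; $M$ is a module of $G$ if no vertex of $V(G)-M$ distinguishes it. Given the induced 4-cycle $C$ and $v\in V(G)-V(C)$, put $$\mathcal{H}_v=\{H\in\mathcal{Q}_G:\ V(H)\subseteq\{v\}\cup V(C)\text{ and }V(H)\ne V(C)\}.$$ *)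

theory Defs
  imports Complex_Main
begin

datatype 'a graph = Graph (verts: "'a set") (edges: "'a set set")

definition simple_graph :: "'a graph \<Rightarrow> bool" where
  "simple_graph G \<longleftrightarrow> finite (verts G) \<and> (\<forall>e\<in>edges G. e \<subseteq> verts G \<and> card e = 2)"

definition nbhd :: "'a graph \<Rightarrow> 'a \<Rightarrow> 'a set" where
  "nbhd G v = {u. {u, v} \<in> edges G}"

definition isomorphic :: "'a graph \<Rightarrow> 'b graph \<Rightarrow> bool" (infix "\<approx>" 50) where
  "G \<approx> H \<longleftrightarrow> (\<exists>f. bij_betw f (verts G) (verts H) \<and>
     (\<forall>u\<in>verts G. \<forall>v\<in>verts G. {u, v} \<in> edges G \<longleftrightarrow> {f u, f v} \<in> edges H))"

definition induced_subgraph :: "'a graph \<Rightarrow> 'a graph \<Rightarrow> bool" where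
  "induced_subgraph H G \<longleftrightarrow>
     verts H \<subseteq> verts G \<and> edges H = {e \<in> edges G. e \<subseteq> verts H}"

definition P4 :: "nat graph" where
  "P4 = Graph {0, 1, 2, 3} {{0, 1}, {1, 2}, {2, 3}}"

definition C4 :: "nat graph" where
  "C4 = Graph {0, 1, 2, 3} {{0, 1}, {1, 2}, {2, 3}, {3, 0}}"

definition two_K2 :: "nat graph" where
  "two_K2 = Graph {0, 1, 2, 3} {{0, 1}, {2, 3}}"

text \<open>A 2-switch is encoded as the pair (set of deleted edges, set of added edges), so that
  different labellings \<open>a, b, x, y\<close> of the same replacement are identified.\<close>

definition two_switches :: "'a graph \<Rightarrow> ('a set set \<times> 'a set set) set" where
  "two_switches G =
     {({{a, b}, {x, y}}, {{a, x}, {b, y}}) | a b x y.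
        distinct [a, b, x, y] \<and> {a, b, x, y} \<subseteq> verts G \<and>
        {a, b} \<in> edges G \<and> {x, y} \<in> edges G \<and>
        {a, x} \<notin> edges G \<and> {b, y} \<notin> edges G}"

definition switch_degree :: "'a graph \<Rightarrow> nat" where
  "switch_degree G = card (two_switches G)"

definition Q_set :: "'a graph \<Rightarrow> 'a graph set" where
  "Q_set G = {H. induced_subgraph H G \<and> (H \<approx> P4 \<or> H \<approx> C4 \<or> H \<approx> two_K2)}"

definition H_set :: "'a graph \<Rightarrow> 'a graph \<Rightarrow> 'a \<Rightarrow> 'a graph set" where
  "H_set G C v = {H \<in> Q_set G. verts H \<subseteq> {v} \<union> verts C \<and> verts H \<noteq> verts C}"

definition distinguishes :: "'a graph \<Rightarrow> 'a \<Rightarrow> 'a set \<Rightarrow> bool" where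
  "distinguishes G v M \<longleftrightarrow>
     v \<in> verts G - M \<and> nbhd G v \<inter> M \<noteq> {} \<and> nbhd G v \<inter> M \<noteq> M"

definition is_module :: "'a graph \<Rightarrow> 'a set \<Rightarrow> bool" where
  "is_module G M \<longleftrightarrow> M \<subseteq> verts G \<and> \<not> (\<exists>v \<in> verts G - M. distinguishes G v M)"

text \<open>In a 4-cycle each vertex is opposite to the unique other vertex not adjacent to it.
  Meaningful only when \<open>C\<close> is a 4-cycle.\<close>

definition opposite :: "'a graph \<Rightarrow> 'a \<Rightarrow> 'a \<Rightarrow> bool" where
  "opposite C p q \<longleftrightarrow> p \<in> verts C \<and> q \<in> verts C \<and> p \<noteq> q \<and> {p, q} \<notin> edges C"

end

theory Submission
  imports Defs
begin

text \<open>
  Every 2-switch touches exactly four vertices, and whether it can be performed depends only on the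
  subgraph that these four vertices induce. A graph on four vertices admits a 2-switch precisely
  when it is a \<open>P\<^sub>4\<close>, a \<open>C\<^sub>4\<close> or a \<open>2K\<^sub>2\<close>: deleting \<open>ab, xy\<close> and adding \<open>ax, by\<close> prescribes
  four of the six pairs, and the other two pairs \<open>bx\<close>, \<open>ay\<close> may be chosen freely. Sorting the
  2-switches of \<open>G\<close> by their support therefore gives
  \<open>deg G = (\<Sum>H\<in>Q_set G. deg H)\<close> with all summands positive (lemmas
  \<open>sum_switch_degree_Q\<close> and \<open>switch_degree_Q_pos\<close>). The graph \<open>C\<close>, with \<open>deg C = 2\<close>, and the
  members of the pairwise disjoint sets \<open>H_set G C v\<close> are among the summands; this is
  the inequality, and it is strict exactly when a summand is left over.

  For the remaining claims, consider an edge \<open>pq\<close> of \<open>C\<close> such that \<open>v\<close> is adjacent to \<open>p\<close> but not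
  to \<open>q\<close>, and let \<open>r\<close> be the vertex opposite to \<open>p\<close>. Replacing \<open>vp, qr\<close> by \<open>vq, pr\<close> is a
  2-switch supported by \<open>v\<close> and three vertices of \<open>C\<close>, and different pairs \<open>(p, q)\<close> give
  different 2-switches. If \<open>v\<close> distinguishes \<open>C\<close>, then adjacency to \<open>v\<close> changes at least twice
  around the cycle, so \<open>v\<close> contributes at least 2 to the sum. If the neighbours of \<open>v\<close> in \<open>C\<close> are a pair
  of opposite vertices, it changes four times, so \<open>v\<close> contributes at least 4.
\<close>

section \<open>Switches and their supports\<close>

definition switch_support :: "'a set set \<times> 'a set set \<Rightarrow> 'a set" where
  "switch_support s = \<Union> (fst s)"

definition induced_on :: "'a graph \<Rightarrow> 'a set \<Rightarrow> 'a graph" where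
  "induced_on G W = Graph W {e \<in> edges G. e \<subseteq> W}"

lemma verts_induced_on [simp]: "verts (induced_on G W) = W"
  by (simp add: induced_on_def)

lemma induced_subgraph_induced_on: "W \<subseteq> verts G \<Longrightarrow> induced_subgraph (induced_on G W) G"
  by (simp add: induced_subgraph_def induced_on_def)

lemma induced_subgraph_eq: "induced_subgraph H G \<Longrightarrow> H = induced_on G (verts H)"
  by (cases H) (simp add: induced_subgraph_def induced_on_def)

lemma edge_induced_iff:
  assumes "induced_subgraph H G" "u \<in> verts H" "v \<in> verts H"
  shows "{u, v} \<in> edges H \<longleftrightarrow> {u, v} \<in> edges G"
  using assms by (auto simp: induced_subgraph_def)

lemma simple_induced:
  assumes "simple_graph G" "induced_subgraph H G"
  shows "simple_graph H"
  using assms by (auto simp: simple_graph_def induced_subgraph_def intro: finite_subset)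

lemma no_loop: "simple_graph G \<Longrightarrow> {u} \<notin> edges G"
  by (auto simp: simple_graph_def)

lemma two_switchesI:
  assumes "distinct [a, b, x, y]" "{a, b, x, y} \<subseteq> verts G"
    and "{a, b} \<in> edges G" "{x, y} \<in> edges G" "{a, x} \<notin> edges G" "{b, y} \<notin> edges G"
  shows "({{a, b}, {x, y}}, {{a, x}, {b, y}}) \<in> two_switches G"
  using assms unfolding two_switches_def by blast

lemma two_switchesE:
  assumes "s \<in> two_switches G"
  obtains a b x y where "s = ({{a, b}, {x, y}}, {{a, x}, {b, y}})"
    and "distinct [a, b, x, y]" "{a, b, x, y} \<subseteq> verts G"
    and "{a, b} \<in> edges G" "{x, y} \<in> edges G" "{a, x} \<notin> edges G" "{b, y} \<notin> edges G"
  using assms unfolding two_switches_def by blast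

lemma finite_two_switches:
  assumes "finite (verts G)"
  shows "finite (two_switches G)"
proof (rule finite_subset)
  show "two_switches G \<subseteq> Pow (Pow (verts G)) \<times> Pow (Pow (verts G))"
    by (auto elim!: two_switchesE)
qed (use assms in simp)

text \<open>
  Both the edges and the non-edges required by a 2-switch lie inside its support, and an induced
  subgraph keeps both. The size assumption makes the support fill the subgraph.
\<close>
lemma two_switches_induced:
  assumes "induced_subgraph H G" and card4: "card (verts H) = 4"
  shows "two_switches H = {s \<in> two_switches G. switch_support s = verts H}"
proof (intro set_eqI iffI)
  fix s
  assume "s \<in> two_switches H"
  then obtain a b x y where s: "s = ({{a, b}, {x, y}}, {{a, x}, {b, y}})"
    and d: "distinct [a, b, x, y]" and sub: "{a, b, x, y} \<subseteq> verts H"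
    and e: "{a, b} \<in> edges H" "{x, y} \<in> edges H" "{a, x} \<notin> edges H" "{b, y} \<notin> edges H"
    by (rule two_switchesE)
  have "finite (verts H)"
    using card4 by (rule_tac card_ge_0_finite) simp
  then have "{a, b, x, y} = verts H"
    using sub d card4 by (intro card_subset_eq) auto
  then have "switch_support s = verts H"
    by (auto simp: s switch_support_def)
  moreover have "s \<in> two_switches G"
    unfolding s using d sub e assms(1) edge_induced_iff[OF assms(1)]
    by (intro two_switchesI) (auto simp: induced_subgraph_def)
  ultimately show "s \<in> {s \<in> two_switches G. switch_support s = verts H}"
    by simp
next
  fix s
  assume "s \<in> {s \<in> two_switches G. switch_support s = verts H}"
  then have "s \<in> two_switches G" and supp: "switch_support s = verts H"
    by auto
  then obtain a b x y where s: "s = ({{a, b}, {x, y}}, {{a, x}, {b, y}})"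
    and d: "distinct [a, b, x, y]"
    and e: "{a, b} \<in> edges G" "{x, y} \<in> edges G" "{a, x} \<notin> edges G" "{b, y} \<notin> edges G"
    by (elim two_switchesE)
  have "a \<in> verts H" "b \<in> verts H" "x \<in> verts H" "y \<in> verts H"
    using supp by (auto simp: s switch_support_def)
  then show "s \<in> two_switches H"
    unfolding s using d e edge_induced_iff[OF assms(1)] by (intro two_switchesI) auto
qed

section \<open>The four-vertex graphs that admit a switch\<close>

lemma isomorphic_labelling:
  assumes "H \<approx> K"
  obtains g where "bij_betw g (verts K) (verts H)"
    and "\<forall>i\<in>verts K. \<forall>j\<in>verts K. {g i, g j} \<in> edges H \<longleftrightarrow> {i, j} \<in> edges K"
proof -
  obtain f where f: "bij_betw f (verts H) (verts K)"
    and e: "\<forall>u\<in>verts H. \<forall>v\<in>verts H. {u, v} \<in> edges H \<longleftrightarrow> {f u, f v} \<in> edges K"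
    using assms by (auto simp: isomorphic_def)
  let ?g = "inv_into (verts H) f"
  have "?g i \<in> verts H" "f (?g i) = i" if "i \<in> verts K" for i
    using that f by (auto simp: bij_betw_def inv_into_into f_inv_into_f)
  then show thesis
    using bij_betw_inv_into[OF f] e by (intro that[of ?g]) auto
qed

lemma card_verts_Q:
  assumes "H \<in> Q_set G"
  shows "card (verts H) = 4"
proof -
  have "card (verts P4) = 4" "card (verts C4) = 4" "card (verts two_K2) = 4"
    by (simp_all add: P4_def C4_def two_K2_def)
  moreover have "card (verts H) = card (verts K)" if "H \<approx> K" for K :: "nat graph"
    using that by (auto simp: isomorphic_def intro: bij_betw_same_card)
  ultimately show ?thesis
    using assms by (auto simp: Q_set_def)
qed

text \<open>
  In all three of \<open>P\<^sub>4\<close>, \<open>C\<^sub>4\<close> and \<open>2K\<^sub>2\<close>, with the labels \<open>0, 1, 2, 3\<close> of their definitions,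
  \<open>01\<close> and \<open>23\<close> are edges while \<open>02\<close> and \<open>13\<close> are not.
\<close>
lemma two_switches_Q_nonempty:
  assumes "H \<in> Q_set G"
  shows "two_switches H \<noteq> {}"
proof -
  obtain K :: "nat graph" where "H \<approx> K" and K: "verts K = {0, 1, 2, 3}"
    "{0, 1} \<in> edges K" "{2, 3} \<in> edges K" "{0, 2} \<notin> edges K" "{1, 3} \<notin> edges K"
    using assms
    by (auto simp: Q_set_def P4_def C4_def two_K2_def doubleton_eq_iff)
  obtain g where g: "bij_betw g (verts K) (verts H)"
    and e: "\<forall>i\<in>verts K. \<forall>j\<in>verts K. {g i, g j} \<in> edges H \<longleftrightarrow> {i, j} \<in> edges K"
    by (rule isomorphic_labelling[OF \<open>H \<approx> K\<close>])
  have "({{g 0, g 1}, {g 2, g 3}}, {{g 0, g 2}, {g 1, g 3}}) \<in> two_switches H"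
    using g K by (intro two_switchesI) (auto simp: e bij_betw_def inj_on_def)
  then show ?thesis
    by blast
qed

lemma isomorphic_labelled4:
  assumes d: "distinct [a, b, c, d]" and V: "verts H = {a, b, c, d}" "verts K = {0, 1, 2, 3 :: nat}"
    and "simple_graph H" "simple_graph K"
    and "{a, b} \<in> edges H \<longleftrightarrow> {0, 1} \<in> edges K" "{a, c} \<in> edges H \<longleftrightarrow> {0, 2} \<in> edges K"
    and "{a, d} \<in> edges H \<longleftrightarrow> {0, 3} \<in> edges K" "{b, c} \<in> edges H \<longleftrightarrow> {1, 2} \<in> edges K"
    and "{b, d} \<in> edges H \<longleftrightarrow> {1, 3} \<in> edges K" "{c, d} \<in> edges H \<longleftrightarrow> {2, 3} \<in> edges K"
  shows "H \<approx> K"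
proof -
  let ?f = "\<lambda>u. if u = a then 0 else if u = b then 1 else if u = c then 2 else (3 :: nat)"
  have "bij_betw ?f (verts H) (verts K)"
    using d by (auto simp: V bij_betw_def inj_on_def)
  moreover have "\<forall>u\<in>verts H. \<forall>v\<in>verts H. {u, v} \<in> edges H \<longleftrightarrow> {?f u, ?f v} \<in> edges K"
    using assms no_loop[of H] no_loop[of K] by (auto simp: insert_commute)
  ultimately show ?thesis
    by (auto simp: isomorphic_def)
qed

lemma simple_P4: "simple_graph P4" and simple_C4: "simple_graph C4"
  and simple_two_K2: "simple_graph two_K2"
  by (auto simp: simple_graph_def P4_def C4_def two_K2_def)

text \<open>
  The 2-switch leaves only the pairs \<open>bx\<close> and \<open>ay\<close> undetermined: with both present the support
  is the cycle \<open>a b x y\<close>, with one present it is a path, with none it is \<open>2K\<^sub>2\<close>.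
\<close>
lemma switch_support_in_Q:
  assumes "simple_graph G" "s \<in> two_switches G"
  shows "induced_on G (switch_support s) \<in> Q_set G"
proof -
  obtain a b x y where s: "s = ({{a, b}, {x, y}}, {{a, x}, {b, y}})"
    and d: "distinct [a, b, x, y]" and sub: "{a, b, x, y} \<subseteq> verts G"
    and e: "{a, b} \<in> edges G" "{x, y} \<in> edges G" "{a, x} \<notin> edges G" "{b, y} \<notin> edges G"
    using assms(2) by (rule two_switchesE)
  define H where "H = induced_on G {a, b, x, y}"
  have ind: "induced_subgraph H G"
    unfolding H_def using sub by (rule induced_subgraph_induced_on)
  have simple: "simple_graph H"
    using simple_induced[OF assms(1) ind] .
  have V: "verts H = {a, b, x, y}"
    by (simp add: H_def)
  have eH: "{a, b} \<in> edges H" "{x, y} \<in> edges H" "{a, x} \<notin> edges H" "{b, y} \<notin> edges H"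
    using e edge_induced_iff[OF ind] V by auto
  have "H \<approx> P4 \<or> H \<approx> C4 \<or> H \<approx> two_K2"
  proof (cases "{b, x} \<in> edges H"; cases "{a, y} \<in> edges H")
    assume "{b, x} \<in> edges H" "{a, y} \<in> edges H"
    then have "H \<approx> C4"
      using d V eH simple simple_C4
      by (intro isomorphic_labelled4[of a b x y]) (auto simp: C4_def doubleton_eq_iff)
    then show ?thesis by simp
  next
    assume "{b, x} \<in> edges H" "{a, y} \<notin> edges H"
    then have "H \<approx> P4"
      using d V eH simple simple_P4
      by (intro isomorphic_labelled4[of a b x y]) (auto simp: P4_def doubleton_eq_iff)
    then show ?thesis by simp
  next
    assume "{b, x} \<notin> edges H" "{a, y} \<in> edges H"
    then have "H \<approx> P4"
      using d V eH simple simple_P4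
      by (intro isomorphic_labelled4[of b a y x])
        (auto simp: P4_def doubleton_eq_iff insert_commute)
    then show ?thesis by simp
  next
    assume "{b, x} \<notin> edges H" "{a, y} \<notin> edges H"
    then have "H \<approx> two_K2"
      using d V eH simple simple_two_K2
      by (intro isomorphic_labelled4[of a b x y]) (auto simp: two_K2_def doubleton_eq_iff)
    then show ?thesis by simp
  qed
  moreover have "switch_support s = {a, b, x, y}"
    by (auto simp: s switch_support_def)
  ultimately show ?thesis
    using ind by (simp add: Q_set_def H_def)
qed

section \<open>Counting switches by their supports\<close>

lemma finite_Q_set:
  assumes "simple_graph G"
  shows "finite (Q_set G)"
proof (rule finite_subset)
  show "Q_set G \<subseteq> induced_on G ` Pow (verts G)"
  proof
    fix H
    assume "H \<in> Q_set G"
    then have "induced_subgraph H G"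
      by (simp add: Q_set_def)
    then have "H = induced_on G (verts H)" "verts H \<in> Pow (verts G)"
      using induced_subgraph_eq by (blast, simp add: induced_subgraph_def)
    then show "H \<in> induced_on G ` Pow (verts G)"
      by (rule image_eqI)
  qed
qed (use assms in \<open>simp add: simple_graph_def\<close>)

text \<open>
  Stated for arbitrary subfamilies of \<open>Q_set G\<close>, so that it serves both the whole family and the
  families attached to a single vertex outside \<open>C\<close>.
\<close>
lemma sum_switch_degree:
  assumes "simple_graph G" and A: "A \<subseteq> Q_set G"
  shows "(\<Sum>H\<in>A. switch_degree H) =
    card {s \<in> two_switches G. induced_on G (switch_support s) \<in> A}"
proof -
  have fin: "finite (two_switches G)"
    using assms(1) by (intro finite_two_switches) (simp add: simple_graph_def)
  have sw: "two_switches H = {s \<in> two_switches G. induced_on G (switch_support s) = H}"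
    if "H \<in> A" for H
  proof -
    have "induced_subgraph H G"
      using that A by (auto simp: Q_set_def)
    moreover from this have "switch_support s = verts H \<longleftrightarrow> induced_on G (switch_support s) = H" for s
      using induced_subgraph_eq[of H G] verts_induced_on[of G "switch_support s"] by auto
    ultimately show ?thesis
      using two_switches_induced[of H G] card_verts_Q[of H G] that A by auto
  qed
  have "finite A"
    using finite_subset[OF A finite_Q_set[OF assms(1)]] .
  then have "(\<Sum>H\<in>A. switch_degree H) = card (\<Union>H\<in>A. two_switches H)"
    unfolding switch_degree_def
    by (intro card_UN_disjoint[symmetric]) (auto simp: sw fin)
  also have "(\<Union>H\<in>A. two_switches H) = {s \<in> two_switches G. induced_on G (switch_support s) \<in> A}"
    by (auto simp: sw)
  finally show ?thesis .
qed

lemma sum_switch_degree_Q: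
  assumes "simple_graph G"
  shows "switch_degree G = (\<Sum>H\<in>Q_set G. switch_degree H)"
proof -
  have "{s \<in> two_switches G. induced_on G (switch_support s) \<in> Q_set G} = two_switches G"
    using switch_support_in_Q[OF assms] by auto
  then show ?thesis
    using sum_switch_degree[OF assms subset_refl] by (simp add: switch_degree_def)
qed

lemma switch_degree_Q_pos:
  assumes "simple_graph G" "H \<in> Q_set G"
  shows "switch_degree H > 0"
proof -
  have "finite (verts H)"
    using simple_induced[OF assms(1), of H] assms(2) by (simp add: Q_set_def simple_graph_def)
  then show ?thesis
    using finite_two_switches two_switches_Q_nonempty[OF assms(2)]
    by (auto simp: switch_degree_def card_gt_0_iff)
qed

text \<open>
  Members of \<open>Q_set G\<close> have four vertices, so one that avoids \<open>v\<close> would fill \<open>C\<close>. This makes the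
  families \<open>H_set G C v\<close> disjoint for different \<open>v\<close>.
\<close>
lemma vertex_in_H_set:
  assumes "card (verts C) = 4" "H \<in> H_set G C v"
  shows "v \<in> verts H"
proof (rule ccontr)
  assume "v \<notin> verts H"
  then have "verts H \<subseteq> verts C"
    using assms(2) by (auto simp: H_set_def)
  moreover have "finite (verts C)"
    using assms(1) by (rule_tac card_ge_0_finite) simp
  moreover have "card (verts H) = 4"
    using assms(2) card_verts_Q by (auto simp: H_set_def)
  ultimately have "verts H = verts C"
    using assms(1) by (intro card_subset_eq) auto
  then show False
    using assms(2) by (simp add: H_set_def)
qed

section \<open>Labelled 4-cycles\<close>

definition four_cycle :: "'a graph \<Rightarrow> 'a \<Rightarrow> 'a \<Rightarrow> 'a \<Rightarrow> 'a \<Rightarrow> bool" where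
  "four_cycle C a b c d \<longleftrightarrow> distinct [a, b, c, d] \<and> verts C = {a, b, c, d} \<and>
     {a, b} \<in> edges C \<and> {b, c} \<in> edges C \<and> {c, d} \<in> edges C \<and> {d, a} \<in> edges C \<and>
     {a, c} \<notin> edges C \<and> {b, d} \<notin> edges C"

lemma four_cycle_rotate: "four_cycle C a b c d \<Longrightarrow> four_cycle C b c d a"
  by (auto simp: four_cycle_def insert_commute)

lemma four_cycle_reflect: "four_cycle C a b c d \<Longrightarrow> four_cycle C a d c b"
  by (auto simp: four_cycle_def insert_commute)

lemma four_cycle_card: "four_cycle C a b c d \<Longrightarrow> card (verts C) = 4"
  by (auto simp: four_cycle_def)

lemma four_cycle_exists:
  assumes "C \<approx> C4"
  obtains a b c d where "four_cycle C a b c d"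
proof -
  obtain g where g: "bij_betw g (verts C4) (verts C)"
    and e: "\<forall>i\<in>verts C4. \<forall>j\<in>verts C4. {g i, g j} \<in> edges C \<longleftrightarrow> {i, j} \<in> edges C4"
    by (rule isomorphic_labelling[OF assms])
  have "inj_on g {0, 1, 2, 3}" "verts C = g ` {0, 1, 2, 3}"
    using g by (auto simp: C4_def bij_betw_def)
  moreover have "{g 0, g 1} \<in> edges C" "{g 1, g 2} \<in> edges C" "{g 2, g 3} \<in> edges C"
    "{g 3, g 0} \<in> edges C" "{g 0, g 2} \<notin> edges C" "{g 1, g 3} \<notin> edges C"
    using e by (auto simp: C4_def doubleton_eq_iff)
  ultimately have "four_cycle C (g 0) (g 1) (g 2) (g 3)"
    by (simp add: four_cycle_def inj_on_def)
  then show thesis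
    by (rule that)
qed

text \<open>
  A 2-switch on four vertices adds two disjoint non-edges, which in a 4-cycle must be the two
  diagonals; so it deletes one of the two pairs of parallel sides.
\<close>
lemma switch_degree_four_cycle:
  assumes cyc: "four_cycle C a b c d"
  shows "switch_degree C = 2"
proof -
  let ?S = "{({{a, b}, {c, d}}, {{a, c}, {b, d}}), ({{b, c}, {d, a}}, {{a, c}, {b, d}})}"
  have dist: "a \<noteq> b" "a \<noteq> c" "a \<noteq> d" "b \<noteq> c" "b \<noteq> d" "c \<noteq> d"
    using cyc by (auto simp: four_cycle_def)
  have edge: "{a, b} \<in> edges C" "{b, c} \<in> edges C" "{c, d} \<in> edges C" "{d, a} \<in> edges C"
    "{b, a} \<in> edges C" "{c, b} \<in> edges C" "{d, c} \<in> edges C" "{a, d} \<in> edges C"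
    and nonedge: "{a, c} \<notin> edges C" "{b, d} \<notin> edges C" "{c, a} \<notin> edges C" "{d, b} \<notin> edges C"
    using cyc by (simp_all add: four_cycle_def insert_commute)
  have "two_switches C \<subseteq> ?S"
  proof
    fix s
    assume "s \<in> two_switches C"
    then obtain p q x y where s: "s = ({{p, q}, {x, y}}, {{p, x}, {q, y}})"
      and d: "distinct [p, q, x, y]" and sub: "{p, q, x, y} \<subseteq> verts C"
      and e: "{p, q} \<in> edges C" "{x, y} \<in> edges C" "{p, x} \<notin> edges C" "{q, y} \<notin> edges C"
      by (rule two_switchesE)
    have diag: "(u, v) \<in> {(a, c), (c, a), (b, d), (d, b)}"
      if "u \<in> verts C" "v \<in> verts C" "u \<noteq> v" "{u, v} \<notin> edges C" for u v
    proof -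
      have "u \<in> {a, b, c, d}" "v \<in> {a, b, c, d}"
        using that(1,2) cyc by (simp_all add: four_cycle_def)
      then show ?thesis
        using that(3,4) edge by (elim insertE emptyE; simp)
    qed
    have "(p, x) \<in> {(a, c), (c, a), (b, d), (d, b)}" "(q, y) \<in> {(a, c), (c, a), (b, d), (d, b)}"
      using diag[of p x] diag[of q y] d sub e by simp_all
    then consider "p = a" "x = c" "q = b" "y = d" | "p = a" "x = c" "q = d" "y = b"
      | "p = c" "x = a" "q = b" "y = d" | "p = c" "x = a" "q = d" "y = b"
      | "p = b" "x = d" "q = a" "y = c" | "p = b" "x = d" "q = c" "y = a"
      | "p = d" "x = b" "q = a" "y = c" | "p = d" "x = b" "q = c" "y = a"
      using d by force
    then show "s \<in> ?S"
      unfolding s by cases (simp_all add: insert_commute)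
  qed
  moreover have "({{a, b}, {c, d}}, {{a, c}, {b, d}}) \<in> two_switches C"
    by (rule two_switchesI) (use dist edge nonedge cyc in \<open>simp_all add: four_cycle_def\<close>)
  moreover have "({{b, c}, {d, a}}, {{b, d}, {c, a}}) \<in> two_switches C"
    by (rule two_switchesI) (use dist edge nonedge cyc in \<open>simp_all add: four_cycle_def\<close>)
  moreover have "{{b, d}, {c, a}} = {{a, c}, {b, d}}"
    by (simp add: insert_commute)
  ultimately have "two_switches C = ?S"
    by auto
  moreover have "{{a, b}, {c, d}} \<noteq> {{b, c}, {d, a}}"
    using dist by (auto simp: doubleton_eq_iff)
  ultimately show ?thesis
    by (simp add: switch_degree_def)
qed

section \<open>The contribution of a vertex outside the cycle\<close>

text \<open>
  Used for a vertex \<open>v\<close> outside the cycle and an edge \<open>pq\<close> of the cycle such that \<open>v\<close> is adjacent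
  to \<open>p\<close> but not to \<open>q\<close>; the vertex \<open>r\<close> is the one opposite to \<open>p\<close>.
\<close>
definition boundary_switch :: "'a \<Rightarrow> 'a \<Rightarrow> 'a \<Rightarrow> 'a \<Rightarrow> 'a set set \<times> 'a set set" where
  "boundary_switch v p q r = ({{v, p}, {q, r}}, {{v, q}, {p, r}})"

text \<open>The vertices \<open>p\<close> and \<open>q\<close> are the partners of \<open>v\<close> in the deleted and in the added edges, and
  then \<open>r\<close> is the partner of \<open>p\<close> in the other added edge.\<close>
lemma boundary_switch_inject:
  assumes "v \<notin> {p, q, r, p', q', r'}"
  shows "boundary_switch v p q r = boundary_switch v p' q' r' \<longleftrightarrow> p = p' \<and> q = q' \<and> r = r'"
proof
  assume "boundary_switch v p q r = boundary_switch v p' q' r'"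
  then have del: "{{v, p}, {q, r}} = {{v, p'}, {q', r'}}"
    and add: "{{v, q}, {p, r}} = {{v, q'}, {p', r'}}"
    by (simp_all only: boundary_switch_def prod.inject)
  have "{v, p} \<noteq> {q', r'}" "{v, q} \<noteq> {p', r'}" "{p, r} \<noteq> {v, q'}"
    using assms by (auto simp: doubleton_eq_iff)
  moreover have "{v, p} \<in> {{v, p'}, {q', r'}}"
    unfolding del[symmetric] by (rule insertI1)
  moreover have "{v, q} \<in> {{v, q'}, {p', r'}}" "{p, r} \<in> {{v, q'}, {p', r'}}"
    unfolding add[symmetric] by (rule insertI1, rule insertI2, rule insertI1)
  ultimately have "{v, p} = {v, p'}" "{v, q} = {v, q'}" "{p, r} = {p', r'}"
    by simp_all
  then show "p = p' \<and> q = q' \<and> r = r'"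
    by (metis doubleton_eq_iff)
qed simp

definition attached_switches :: "'a graph \<Rightarrow> 'a graph \<Rightarrow> 'a \<Rightarrow> ('a set set \<times> 'a set set) set" where
  "attached_switches G C v =
     {s \<in> two_switches G. induced_on G (switch_support s) \<in> H_set G C v}"

lemma card_le_sum_H_set:
  assumes "simple_graph G" "T \<subseteq> attached_switches G C v"
  shows "card T \<le> (\<Sum>H\<in>H_set G C v. switch_degree H)"
proof -
  have "finite (attached_switches G C v)"
    using finite_two_switches[of G] assms(1) by (auto simp: attached_switches_def simple_graph_def)
  then have "card T \<le> card (attached_switches G C v)"
    using assms(2) by (rule card_mono)
  also have "\<dots> = (\<Sum>H\<in>H_set G C v. switch_degree H)"
    unfolding attached_switches_def
    by (rule sum_switch_degree[OF assms(1), symmetric]) (auto simp: H_set_def)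
  finally show ?thesis .
qed

text \<open>
  The edges \<open>va\<close>, \<open>bc\<close> can be exchanged for \<open>vb\<close>, \<open>ac\<close>: the first of these is a non-edge by
  assumption, the second is a diagonal of an induced cycle.
\<close>
lemma boundary_switch_attached:
  assumes "simple_graph G" and ind: "induced_subgraph C G" and cyc: "four_cycle C a b c d"
    and v: "v \<in> verts G - verts C" and "a \<in> nbhd G v" "b \<notin> nbhd G v"
  shows "boundary_switch v a b c \<in> attached_switches G C v"
proof -
  have V: "verts C = {a, b, c, d}" and dist: "distinct [a, b, c, d]"
    using cyc by (auto simp: four_cycle_def)
  have "{b, c} \<in> edges G" "{a, c} \<notin> edges G"
    using cyc edge_induced_iff[OF ind] by (auto simp: four_cycle_def)
  moreover have "{v, a} \<in> edges G" "{v, b} \<notin> edges G"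
    using assms(5,6) by (auto simp: nbhd_def insert_commute)
  moreover have "verts C \<subseteq> verts G"
    using ind by (simp add: induced_subgraph_def)
  ultimately have sw: "boundary_switch v a b c \<in> two_switches G"
    unfolding boundary_switch_def using v V dist by (intro two_switchesI) auto
  have supp: "switch_support (boundary_switch v a b c) = {v, a, b, c}"
    by (auto simp: switch_support_def boundary_switch_def)
  have "induced_on G (switch_support (boundary_switch v a b c)) \<in> H_set G C v"
    using switch_support_in_Q[OF assms(1) sw] v V by (auto simp: H_set_def supp)
  then show ?thesis
    using sw by (simp add: attached_switches_def)
qed

text \<open>Adjacency to \<open>v\<close> is not constant around the cycle, so it is lost along some edge.\<close>
lemma distinguishes_boundary:
  assumes "C \<approx> C4" "distinguishes G v (verts C)"
  obtains a b c d where "four_cycle C a b c d" "a \<in> nbhd G v" "b \<notin> nbhd G v"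
proof -
  obtain a b c d where cyc: "four_cycle C a b c d"
    using four_cycle_exists[OF assms(1)] .
  have "verts C = {a, b, c, d}"
    using cyc by (simp add: four_cycle_def)
  then have "(\<exists>u\<in>{a, b, c, d}. u \<in> nbhd G v) \<and> (\<exists>u\<in>{a, b, c, d}. u \<notin> nbhd G v)"
    using assms(2) by (auto simp: distinguishes_def)
  then consider "a \<in> nbhd G v" "b \<notin> nbhd G v" | "b \<in> nbhd G v" "c \<notin> nbhd G v"
    | "c \<in> nbhd G v" "d \<notin> nbhd G v" | "d \<in> nbhd G v" "a \<notin> nbhd G v"
    by blast
  then show thesis
    using that cyc by cases (metis four_cycle_rotate)+
qed

text \<open>
  Adjacency to \<open>v\<close> is lost along one edge of the cycle and regained along another, and each of
  these two edges yields its own 2-switch.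
\<close>
lemma distinguishing_contributes_2:
  assumes "simple_graph G" and ind: "induced_subgraph C G" and "C \<approx> C4"
    and dis: "distinguishes G v (verts C)"
  shows "2 \<le> (\<Sum>H\<in>H_set G C v. switch_degree H)"
proof -
  obtain a b c d where cyc: "four_cycle C a b c d" and ab: "a \<in> nbhd G v" "b \<notin> nbhd G v"
    using distinguishes_boundary[OF assms(3) dis] .
  have v: "v \<in> verts G - verts C"
    using dis by (simp add: distinguishes_def)
  note attached = boundary_switch_attached[OF assms(1) ind _ v]
  have d: "distinct [a, b, c, d]" "v \<notin> {a, b, c, d}"
    using cyc v by (auto simp: four_cycle_def)
  have cycs: "four_cycle C c b a d" "four_cycle C d c b a" "four_cycle C a d c b"
    using cyc by (auto simp: four_cycle_def insert_commute)
  \<comment> \<open>Continuing from \<open>b\<close> to \<open>c\<close>, \<open>d\<close> and back to \<open>a\<close>, adjacency must be regained somewhere.\<close>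
  consider "c \<in> nbhd G v" | "c \<notin> nbhd G v" "d \<in> nbhd G v" | "d \<notin> nbhd G v"
    by blast
  then obtain s where s: "s \<in> attached_switches G C v" "s \<noteq> boundary_switch v a b c"
  proof cases
    case 1
    show thesis
      by (rule that[OF attached[OF cycs(1) 1 ab(2)]])
        (use d in \<open>subst boundary_switch_inject; auto\<close>)
  next
    case 2
    show thesis
      by (rule that[OF attached[OF cycs(2) 2(2,1)]])
        (use d in \<open>subst boundary_switch_inject; auto\<close>)
  next
    case 3
    show thesis
      by (rule that[OF attached[OF cycs(3) ab(1) 3]])
        (use d in \<open>subst boundary_switch_inject; auto\<close>)
  qed
  then have "card {s, boundary_switch v a b c} \<le> (\<Sum>H\<in>H_set G C v. switch_degree H)"
    using attached[OF cyc ab] by (intro card_le_sum_H_set[OF assms(1)]) auto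
  then show ?thesis
    using s by simp
qed

text \<open>Each of the four edges of the cycle joins a neighbour of \<open>v\<close> to a non-neighbour of \<open>v\<close>.\<close>
lemma opposite_contributes_4:
  assumes "simple_graph G" and ind: "induced_subgraph C G" and "C \<approx> C4"
    and v: "v \<in> verts G - verts C"
    and opp: "opposite C p q" and N: "nbhd G v \<inter> verts C = {p, q}"
  shows "4 \<le> (\<Sum>H\<in>H_set G C v. switch_degree H)"
proof -
  obtain a b c d where cyc0: "four_cycle C a b c d"
    using four_cycle_exists[OF assms(3)] .
  have "{p, q} = {a, c} \<or> {p, q} = {b, d}"
    using cyc0 opp by (auto simp: four_cycle_def opposite_def insert_commute)
  then obtain a b c d where cyc: "four_cycle C a b c d" and pq: "{p, q} = {a, c}"
    using cyc0 four_cycle_rotate[OF cyc0] by metis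
  have d: "distinct [a, b, c, d]" "v \<notin> {a, b, c, d}" "verts C = {a, b, c, d}"
    using cyc v by (auto simp: four_cycle_def)
  have adj: "u \<in> nbhd G v \<longleftrightarrow> u \<in> {a, c}" if "u \<in> {a, b, c, d}" for u
    using N that d(3) pq by blast
  have mem: "a \<in> nbhd G v" "c \<in> nbhd G v" "b \<notin> nbhd G v" "d \<notin> nbhd G v"
    using adj[of a] adj[of b] adj[of c] adj[of d] d(1) by auto
  have cycs: "four_cycle C a d c b" "four_cycle C c b a d" "four_cycle C c d a b"
    using cyc by (auto simp: four_cycle_def insert_commute)
  note attached = boundary_switch_attached[OF assms(1) ind _ v]
  let ?T = "{boundary_switch v a b c, boundary_switch v a d c,
    boundary_switch v c b a, boundary_switch v c d a}"
  have "?T \<subseteq> attached_switches G C v"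
    using attached[OF cyc] attached[OF cycs(1)] attached[OF cycs(2)] attached[OF cycs(3)] mem by auto
  then have "card ?T \<le> (\<Sum>H\<in>H_set G C v. switch_degree H)"
    by (rule card_le_sum_H_set[OF assms(1)])
  moreover have "card ?T = 4"
    using d by (simp add: boundary_switch_inject)
  ultimately show ?thesis
    by simp
qed

section \<open>The degree bound\<close>

theorem theorem2p13:
  fixes G C :: "'a graph"
  assumes "simple_graph G"
    and "induced_subgraph C G"
    and "C \<approx> C4"
  shows "switch_degree G
           \<ge> 2 + (\<Sum>v\<in>verts G - verts C. \<Sum>H\<in>H_set G C v. switch_degree H)
       \<and> (switch_degree G
           = 2 + (\<Sum>v\<in>verts G - verts C. \<Sum>H\<in>H_set G C v. switch_degree H)
          \<longleftrightarrow> Q_set G = {C} \<union> (\<Union>v\<in>verts G - verts C. H_set G C v))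
       \<and> int (card {v. distinguishes G v (verts C)})
           \<le> \<lfloor>(real (switch_degree G) - 2) / 2\<rfloor>
       \<and> (switch_degree G \<le> 3 \<longrightarrow> is_module G (verts C))
       \<and> (switch_degree G \<le> 5 \<longrightarrow>
            card {v. distinguishes G v (verts C)} \<le> 1 \<and>
            (\<forall>v. distinguishes G v (verts C) \<longrightarrow>
              \<not> (\<exists>p q. opposite C p q \<and> nbhd G v \<inter> verts C = {p, q})))"
proof -
  note simple = assms(1) and ind = assms(2) and iso = assms(3)
  define f where "f v = (\<Sum>H\<in>H_set G C v. switch_degree H)" for v
  define B where "B = (\<Union>v\<in>verts G - verts C. H_set G C v)"
  define D where "D = {v. distinguishes G v (verts C)}"
  obtain a b c d where cyc: "four_cycle C a b c d"
    using four_cycle_exists[OF iso] .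
  have finV: "finite (verts G - verts C)"
    using simple by (simp add: simple_graph_def)
  have finQ: "finite (Q_set G)"
    using finite_Q_set[OF simple] .
  have HQ: "H_set G C v \<subseteq> Q_set G" for v
    by (auto simp: H_set_def)
  have BQ: "B \<subseteq> Q_set G"
    using HQ by (auto simp: B_def)
  have CQ: "C \<in> Q_set G"
    using ind iso by (simp add: Q_set_def)
  have CB: "C \<notin> B"
    by (auto simp: B_def H_set_def)
  have finB: "finite B"
    using finite_subset[OF BQ finQ] .
  have disj: "H_set G C v \<inter> H_set G C w = {}"
    if "v \<in> verts G - verts C" "v \<noteq> w" for v w
    using that vertex_in_H_set[OF four_cycle_card[OF cyc], of _ G v] by (auto simp: H_set_def)
  have sumB: "(\<Sum>v\<in>verts G - verts C. f v) = (\<Sum>H\<in>B. switch_degree H)"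
    unfolding B_def f_def
    using finV finite_subset[OF HQ finQ] disj by (intro sum.UNION_disjoint[symmetric]) auto
  have degC: "switch_degree C = 2"
    using switch_degree_four_cycle[OF cyc] .
  define R where "R = Q_set G - ({C} \<union> B)"
  have "switch_degree G = (\<Sum>H\<in>R. switch_degree H) + (\<Sum>H\<in>{C} \<union> B. switch_degree H)"
    unfolding sum_switch_degree_Q[OF simple] R_def
    using BQ CQ finQ by (intro sum.subset_diff) auto
  then have deg: "switch_degree G = 2 + (\<Sum>v\<in>verts G - verts C. f v) + (\<Sum>H\<in>R. switch_degree H)"
    using CB finB degC sumB by simp
  have "(\<Sum>H\<in>R. switch_degree H) = 0 \<longleftrightarrow> R = {}"
    using finQ switch_degree_Q_pos[OF simple] by (fastforce simp: R_def)
  moreover have "R = {} \<longleftrightarrow> Q_set G = {C} \<union> B"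
    using BQ CQ by (auto simp: R_def)
  ultimately have eq: "switch_degree G = 2 + (\<Sum>v\<in>verts G - verts C. f v) \<longleftrightarrow> Q_set G = {C} \<union> B"
    using deg by simp
  have D: "D \<subseteq> verts G - verts C"
    by (auto simp: D_def distinguishes_def)
  have finD: "finite D"
    using finite_subset[OF D finV] .
  have "2 * card D \<le> (\<Sum>v\<in>D. f v)"
    using sum_bounded_below[of D 2 f] distinguishing_contributes_2[OF simple ind iso]
    by (simp add: D_def f_def mult.commute)
  also have "\<dots> \<le> (\<Sum>v\<in>verts G - verts C. f v)"
    using D finV by (intro sum_mono2) auto
  finally have bound: "2 + 2 * card D \<le> switch_degree G"
    using deg by simp
  then have "int (card D) \<le> \<lfloor>(real (switch_degree G) - 2) / 2\<rfloor>"
    by (simp add: le_floor_iff)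
  moreover have "is_module G (verts C)" if "switch_degree G \<le> 3"
  proof -
    have "D = {}"
      using bound that finD by (simp flip: card_0_eq)
    then show ?thesis
      using ind by (auto simp: is_module_def D_def induced_subgraph_def)
  qed
  moreover have "\<not> (\<exists>p q. opposite C p q \<and> nbhd G v \<inter> verts C = {p, q})"
    if "switch_degree G \<le> 5" "distinguishes G v (verts C)" for v
  proof
    assume "\<exists>p q. opposite C p q \<and> nbhd G v \<inter> verts C = {p, q}"
    moreover have v: "v \<in> verts G - verts C"
      using that(2) by (simp add: distinguishes_def)
    ultimately have "4 \<le> f v"
      using opposite_contributes_4[OF simple ind iso] by (auto simp: f_def)
    also have "f v \<le> (\<Sum>v\<in>verts G - verts C. f v)"
      using v finV by (intro member_le_sum) auto
    finally show False
      using deg that(1) by simp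
  qed
  ultimately show ?thesis
    using deg eq bound unfolding f_def[symmetric] B_def[symmetric] D_def[symmetric] by auto
qed

end
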